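(* For every integer $n\ge 1$, $$\mathrm{pf}_n(132,231,321)=C_n+(n-1)C_{n-1},$$ where $C_k=\frac{1}{k+1}\binom{2k}{k}$ is the $k$th Catalan number.
   Context: A Dyck path of semilength $n$ is a lattice path from $(0,0)$ to $(n,n)$ consisting of $n$ north steps $N=(0,1)$ and $n$ east steps $E=(1,0)$ that never goes below the line $y=x$. A parking function of size $n$ is a Dyck path of semilength $n$ whose $n$ north steps are labeled bijectively by $\{1,\dots,n\}$ so that whenever two north steps are consecutive in the path (one immediately following the other), the label of the later one is larger. For a parking function $p$ of size $n$, $\phi(p)$ is the permutation of $\{1,\dots,n\}$ (in one-line notation) obtained by reading the labels of the north steps in the order they occur along the path. A permutation $\pi$ of $\{1,\dots,n\}$ contains a permutation $\rho$ of $\{1,\dots,m\}$ if there are indices $1\le i_1<\cdots<i_m\le n$ such that $\pi_{i_a}\le\pi_{i_b}$ if and only if $\rho_a\le\rho_b$; otherwise $\pi$ avoids $\rho$. For permutations $\rho_1,\dots,\rho_r$, $\mathrm{pf}_n(\rho_1,\dots,\rho_r)$ denotes the number of parking functions $p$ of size $n$ such that $\phi(p)$ avoids each of $\rho_1,\dots,\rho_r$. *)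

theory Defs
  imports Complex_Main
begin

datatype 'a step = is_north: North (label: 'a) | is_east: East

text \<open>
  A path from the origin is the list of its unit steps.  North steps may carry a label:
  a plain lattice path is a \<^typ>\<open>unit step list\<close>, a labelled one a \<^typ>\<open>nat step list\<close>.
\<close>

definition x_coord :: "'a step list \<Rightarrow> nat" where
  "x_coord p = length (filter is_east p)"

definition y_coord :: "'a step list \<Rightarrow> nat" where
  "y_coord p = length (filter is_north p)"

text \<open>
  The prefixes of a path correspond to the lattice points it visits; since the steps are
  axis-parallel, it suffices to look at these points for staying weakly above the diagonal.
\<close>

definition dyck_path :: "nat \<Rightarrow> 'a step list \<Rightarrow> bool" where
  "dyck_path n p \<longleftrightarrow>
     x_coord p = n \<and> y_coord p = n \<and>
     (\<forall>k \<le> length p. x_coord (take k p) \<le> y_coord (take k p))"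

definition \<phi> :: "nat step list \<Rightarrow> nat list" where
  "\<phi> p = map label (filter is_north p)"

text \<open>
  For a list of length \<open>n\<close>, being \<^const>\<open>distinct\<close> with set of entries \<open>{1..n}\<close> says that
  the labelling of the \<open>n\<close> north steps is a bijection onto \<open>{1..n}\<close>.
\<close>

definition parking_function :: "nat \<Rightarrow> nat step list \<Rightarrow> bool" where
  "parking_function n p \<longleftrightarrow>
     dyck_path n p \<and> distinct (\<phi> p) \<and> set (\<phi> p) = {1..n} \<and>
     (\<forall>i a b. Suc i < length p \<and> p ! i = North a \<and> p ! Suc i = North b \<longrightarrow> a < b)"

text \<open>Permutations are lists in one-line notation, with positions counted from 0.\<close>

definition contains_pattern :: "nat list \<Rightarrow> nat list \<Rightarrow> bool" where
  "contains_pattern \<pi> \<rho> \<longleftrightarrow>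
     (\<exists>i :: nat \<Rightarrow> nat.
        strict_mono_on {..<length \<rho>} i \<and> i ` {..<length \<rho>} \<subseteq> {..<length \<pi>} \<and>
        (\<forall>a < length \<rho>. \<forall>b < length \<rho>. \<pi> ! i a \<le> \<pi> ! i b \<longleftrightarrow> \<rho> ! a \<le> \<rho> ! b))"

abbreviation avoids :: "nat list \<Rightarrow> nat list \<Rightarrow> bool" where
  "avoids \<pi> \<rho> \<equiv> \<not> contains_pattern \<pi> \<rho>"

definition pf :: "nat \<Rightarrow> nat list set \<Rightarrow> nat" where
  "pf n R = card {p. parking_function n p \<and> (\<forall>\<rho>\<in>R. avoids (\<phi> p) \<rho>)}"

definition catalan :: "nat \<Rightarrow> real" where
  "catalan k = 1 / (real k + 1) * real ((2 * k) choose k)"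

end

theory Submission
  imports Defs
begin

text \<open>
  In each of 132, 231, 321 the second entry exceeds the third, and the three patterns list all
  possible relative positions of the first entry.  Hence a permutation avoids them all iff its tail
  is increasing, i.e. iff it is \<open>c\<close> followed by the other values in increasing order.
  For \<open>c = 1\<close> every Dyck path can be so labelled, and there are \<open>C\<^sub>n\<close> of them.
  For each of the \<open>n - 1\<close> other values of \<open>c\<close> the only descent is at the start, so the path must
  begin with a north step followed by an east step, after which any Dyck path of semilength \<open>n - 1\<close>
  is allowed.
\<close>

section \<open>Ballot paths\<close>

text \<open>The prefix condition of \<open>dyck_path\<close> with the endpoint left free, so that
  paths can be built by induction on the last step.\<close>

definition ballot_path :: "'a step list \<Rightarrow> bool" where
  "ballot_path p \<longleftrightarrow> (\<forall>k \<le> length p. x_coord (take k p) \<le> y_coord (take k p))"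

text \<open>Once \<open>xs\<close> is fixed, a path is determined by its shape, so these sets stand
  in for unlabelled paths and their size depends on \<open>length xs\<close> and \<open>k\<close>
  alone.\<close>

definition ballot_paths :: "nat list \<Rightarrow> nat \<Rightarrow> nat step list set" where
  "ballot_paths xs k = {p. ballot_path p \<and> \<phi> p = xs \<and> x_coord p = k}"

lemma x_coord_simps [simp]:
  "x_coord [] = 0" "x_coord (p @ q) = x_coord p + x_coord q"
  "x_coord (North a # p) = x_coord p" "x_coord (East # p) = Suc (x_coord p)"
  by (simp_all add: x_coord_def)

lemma y_coord_simps [simp]:
  "y_coord [] = 0" "y_coord (p @ q) = y_coord p + y_coord q"
  "y_coord (North a # p) = Suc (y_coord p)" "y_coord (East # p) = y_coord p"
  by (simp_all add: y_coord_def)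

lemma \<phi>_simps [simp]:
  "\<phi> [] = []" "\<phi> (p @ q) = \<phi> p @ \<phi> q"
  "\<phi> (North a # p) = a # \<phi> p" "\<phi> (East # p) = \<phi> p"
  by (simp_all add: \<phi>_def)

lemma length_\<phi>: "length (\<phi> p) = y_coord p"
  by (simp add: \<phi>_def y_coord_def)

lemma ballot_path_Nil [simp]: "ballot_path []"
  by (simp add: ballot_path_def)

lemma ballot_path_snoc [simp]:
  "ballot_path (p @ [s]) \<longleftrightarrow> ballot_path p \<and> x_coord (p @ [s]) \<le> y_coord (p @ [s])"
  by (auto simp: ballot_path_def le_Suc_eq)

lemma ballot_path_imp_le: "ballot_path p \<Longrightarrow> x_coord p \<le> y_coord p"
  unfolding ballot_path_def by (metis order_refl take_all_iff)

text \<open>The first two steps return to the diagonal at (1,1), so the rest is constrained exactly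
  as if it began at the origin.\<close>

lemma ballot_path_North_East [simp]: "ballot_path (North a # East # q) \<longleftrightarrow> ballot_path q"
proof (induction q rule: rev_induct)
  case Nil
  have "ballot_path ([North a] @ [East])"
    using ballot_path_snoc[of "[]" "North a"] by (subst ballot_path_snoc) simp
  then show ?case by simp
next
  case (snoc s q)
  then show ?case
    using ballot_path_snoc[of "North a # East # q" s] by simp
qed

lemma ballot_paths_eq_empty:
  assumes "length xs < k"
  shows "ballot_paths xs k = {}"
  using assms by (auto simp: ballot_paths_def length_\<phi> dest!: ballot_path_imp_le)

lemma ballot_paths_0: "ballot_paths xs 0 = {map North xs}"
proof (intro set_eqI iffI)
  fix p assume "p \<in> ballot_paths xs 0"
  then have "\<phi> p = xs" "x_coord p = 0" by (simp_all add: ballot_paths_def)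
  then have "p = map North xs"
  proof (induction p arbitrary: xs)
    case (Cons s p)
    then show ?case by (cases s) auto
  qed simp
  then show "p \<in> {map North xs}" by simp
next
  fix p assume "p \<in> {map North xs}"
  moreover have "\<phi> (map North xs) = xs" by (induction xs) simp_all
  moreover have "x_coord (map North ys) = 0" for ys :: "nat list" by (induction ys) simp_all
  ultimately show "p \<in> ballot_paths xs 0"
    by (simp add: ballot_paths_def ballot_path_def take_map)
qed

text \<open>Classification by the last step. The bound on \<open>k\<close> puts the endpoint weakly
  above the diagonal, so appending \<open>East\<close> is always allowed.\<close>

lemma ballot_paths_snoc:
  assumes "k \<le> length xs"
  shows "ballot_paths (xs @ [a]) (Suc k) =
    (\<lambda>p. p @ [North a]) ` ballot_paths xs (Suc k) \<union> (\<lambda>p. p @ [East]) ` ballot_paths (xs @ [a]) k"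
    (is "?L = ?R")
proof
  show "?L \<subseteq> ?R"
  proof
    fix p assume p: "p \<in> ?L"
    then have "p \<noteq> []" by (auto simp: ballot_paths_def)
    then obtain q s where "p = q @ [s]" by (metis rev_exhaust)
    with p show "p \<in> ?R" by (cases s) (auto simp: ballot_paths_def)
  qed
  show "?R \<subseteq> ?L"
    using assms by (auto simp: ballot_paths_def length_\<phi>[symmetric] dest: ballot_path_imp_le)
qed

lemma finite_ballot_paths [simp]: "finite (ballot_paths xs k)"
proof (induction xs arbitrary: k rule: rev_induct)
  case Nil
  then show ?case by (cases k) (simp_all add: ballot_paths_0 ballot_paths_eq_empty)
next
  case (snoc a xs)
  show ?case
  proof (induction k)
    case (Suc k)
    then show ?case
      using snoc ballot_paths_snoc[of k xs a] ballot_paths_eq_empty[of "xs @ [a]" "Suc k"]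
      by (cases "k \<le> length xs") simp_all
  qed (simp add: ballot_paths_0)
qed

lemma card_ballot_paths_snoc:
  assumes "k \<le> length xs"
  shows "card (ballot_paths (xs @ [a]) (Suc k)) =
    card (ballot_paths xs (Suc k)) + card (ballot_paths (xs @ [a]) k)"
  unfolding ballot_paths_snoc[OF assms]
  by (subst card_Un_disjoint) (auto simp: card_image inj_on_def)

text \<open>
  Written additively to avoid truncated subtraction.  The bound includes the column just beyond the
  diagonal, where both binomials agree; this provides the boundary values of the recursion.
\<close>

lemma card_ballot_paths:
  assumes "k \<le> length xs"
  shows "card (ballot_paths xs (Suc k)) + (length xs + Suc k choose k) = (length xs + Suc k choose Suc k)"
  using assms
proof (induction xs arbitrary: k rule: rev_induct)
  case Nil
  then show ?case by (simp add: ballot_paths_eq_empty)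
next
  case (snoc a xs)
  show ?case using snoc.prems
  proof (induction k)
    case 0
    then show ?case
      using snoc.IH[of 0] card_ballot_paths_snoc[of 0 xs a] by (simp add: ballot_paths_0)
  next
    case (Suc k)
    show ?case
    proof (cases "Suc k = Suc (length xs)")
      case True
      \<comment> \<open>Just beyond the diagonal there are no paths, and symmetry makes the two
        binomials equal.\<close>
      then show ?thesis
        using binomial_symmetric[of "Suc k" "Suc k + Suc (Suc k)"]
        by (simp add: ballot_paths_eq_empty)
    next
      case False
      with Suc.prems have "Suc k \<le> length xs" by simp
      \<comment> \<open>The path counts and both binomials obey Pascal's recursion, so the two
        induction hypotheses add up.\<close>
      then show ?thesis
        using Suc.IH snoc.IH[of "Suc k"] card_ballot_paths_snoc[of "Suc k" xs a] by simp
    qed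
  qed
qed

text \<open>For n = \<open>length xs\<close> > 0 the ballot formula gives (2n choose n) - (2n choose
  n-1), and n * (2n choose n) = (n+1) * (2n choose n-1) turns this into the Catalan number.\<close>

lemma card_ballot_paths_catalan: "real (card (ballot_paths xs (length xs))) = catalan (length xs)"
proof (cases "length xs")
  case 0
  then show ?thesis by (simp add: ballot_paths_0 catalan_def)
next
  case (Suc m)
  let ?N = "2 * Suc m"
  \<comment> \<open>Eliminates \<open>y\<close>; applied with \<open>c\<close> the number of paths
    and \<open>x\<close>, \<open>y\<close> the binomials of \<open>?N\<close> over
    \<open>Suc m\<close> and \<open>m\<close>.\<close>
  have arith: "(r + 2) * c = x" if "c + y = x" "(r + 1) * x = (r + 2) * y" for c x y r :: real
    using that(2) unfolding that(1)[symmetric] by (simp add: algebra_simps)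
  have "card (ballot_paths xs (Suc m)) + (?N choose m) = (?N choose Suc m)"
    using card_ballot_paths[of m xs] Suc by (simp add: mult_2)
  then have "real (card (ballot_paths xs (Suc m))) + real (?N choose m) = real (?N choose Suc m)"
    by (metis of_nat_add)
  moreover have "Suc m * (?N choose Suc m) = (m + 2) * (?N choose m)"
  proof -
    have "?N - m = m + 2" by simp
    \<comment> \<open>Both sides equal \<open>?N * (?N - 1 choose m)\<close>.\<close>
    then show ?thesis
      using binomial_absorb_comp[of ?N m] binomial_absorption[of m ?N] by simp
  qed
  then have "real (Suc m) * real (?N choose Suc m) = real (m + 2) * real (?N choose m)"
    unfolding of_nat_mult[symmetric] by (rule arg_cong)
  ultimately have "(real m + 2) * real (card (ballot_paths xs (Suc m))) = real (?N choose Suc m)"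
    by (intro arith[of _ "real (?N choose m)"])
      (simp_all del: binomial_Suc_Suc mult_Suc_right add: add.commute)
  then show ?thesis
    unfolding catalan_def Suc by (simp del: binomial_Suc_Suc mult_Suc_right add: field_simps)
qed

section \<open>The avoiding permutations\<close>

text \<open>Trades the index function for three explicit positions; comparing a position with itself
  is trivial and drops out.\<close>

lemma contains_pattern_3:
  "contains_pattern \<pi> [a, b, c] \<longleftrightarrow>
    (\<exists>x y z. x < y \<and> y < z \<and> z < length \<pi> \<and>
      (\<pi> ! x \<le> \<pi> ! y \<longleftrightarrow> a \<le> b) \<and> (\<pi> ! y \<le> \<pi> ! x \<longleftrightarrow> b \<le> a) \<and>
      (\<pi> ! x \<le> \<pi> ! z \<longleftrightarrow> a \<le> c) \<and> (\<pi> ! z \<le> \<pi> ! x \<longleftrightarrow> c \<le> a) \<and>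
      (\<pi> ! y \<le> \<pi> ! z \<longleftrightarrow> b \<le> c) \<and> (\<pi> ! z \<le> \<pi> ! y \<longleftrightarrow> c \<le> b))"
    (is "?L \<longleftrightarrow> (\<exists>x y z. ?Q x y z)")
proof
  assume ?L
  then obtain i where mono: "strict_mono_on {..<3} i" and ran: "i ` {..<3} \<subseteq> {..<length \<pi>}"
    and pat: "\<forall>u < 3. \<forall>v < 3. \<pi> ! i u \<le> \<pi> ! i v \<longleftrightarrow> [a, b, c] ! u \<le> [a, b, c] ! v"
    unfolding contains_pattern_def by (auto simp: numeral_3_eq_3)
  have "i 0 < i 1" "i 1 < i 2" using mono by (auto simp: strict_mono_on_def)
  moreover have "i 2 < length \<pi>" using ran by (simp add: image_subset_iff)
  ultimately have "?Q (i 0) (i 1) (i 2)"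
    using pat[rule_format, of 0 1] pat[rule_format, of 1 0] pat[rule_format, of 0 2]
      pat[rule_format, of 2 0] pat[rule_format, of 1 2] pat[rule_format, of 2 1]
    by simp
  then show "\<exists>x y z. ?Q x y z" by (intro exI)
next
  assume "\<exists>x y z. ?Q x y z"
  then obtain x y z where "?Q x y z" by (elim exE) (rule that)
  moreover from this have "strict_mono_on {..<3} ((!) [x, y, z])"
    by (auto simp: strict_mono_on_def less_Suc_eq numeral_3_eq_3)
  ultimately show ?L
    unfolding contains_pattern_def
    by (intro exI[of _ "(!) [x, y, z]"])
      (simp add: image_subset_iff Ball_def All_less_Suc numeral_3_eq_3)
qed

lemma avoids_132_231_321_iff:
  assumes "distinct \<pi>"
  shows "(\<forall>\<rho> \<in> {[1, 3, 2], [2, 3, 1], [3, 2, 1]}. avoids \<pi> \<rho>) \<longleftrightarrow> sorted_wrt (<) (tl \<pi>)"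
    (is "?L \<longleftrightarrow> ?R")
proof
  assume L: ?L
  have "\<pi> ! y < \<pi> ! z" if "0 < y" "y < z" "z < length \<pi>" for y z
  proof (rule ccontr)
    assume "\<not> \<pi> ! y < \<pi> ! z"
    moreover have "\<pi> ! 0 \<noteq> \<pi> ! y" "\<pi> ! 0 \<noteq> \<pi> ! z" "\<pi> ! y \<noteq> \<pi> ! z"
      using that nth_eq_iff_index_eq[OF assms, of 0 y] nth_eq_iff_index_eq[OF assms, of 0 z]
        nth_eq_iff_index_eq[OF assms, of y z] by linarith+
    ultimately consider "\<pi> ! 0 < \<pi> ! z" "\<pi> ! z < \<pi> ! y" | "\<pi> ! z < \<pi> ! 0" "\<pi> ! 0 < \<pi> ! y"
      | "\<pi> ! z < \<pi> ! y" "\<pi> ! y < \<pi> ! 0"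
      by linarith
    then have "contains_pattern \<pi> [1, 3, 2] \<or> contains_pattern \<pi> [2, 3, 1] \<or> contains_pattern \<pi> [3, 2, 1]"
    proof cases
      case 1
      then have "contains_pattern \<pi> [1, 3, 2]"
        using that unfolding contains_pattern_3
        by (intro exI[of _ 0] exI[of _ y] exI[of _ z]) simp
      then show ?thesis by simp
    next
      case 2
      then have "contains_pattern \<pi> [2, 3, 1]"
        using that unfolding contains_pattern_3
        by (intro exI[of _ 0] exI[of _ y] exI[of _ z]) simp
      then show ?thesis by simp
    next
      case 3
      then have "contains_pattern \<pi> [3, 2, 1]"
        using that unfolding contains_pattern_3
        by (intro exI[of _ 0] exI[of _ y] exI[of _ z]) simp
      then show ?thesis by simp
    qed
    with L show False by auto
  qed
  then show ?R
    by (auto simp: sorted_wrt_iff_nth_less nth_tl)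
next
  assume ?R
  \<comment> \<open>A position \<open>x\<close> before \<open>y\<close> forces \<open>y\<close> and
    \<open>z\<close> into the tail; this is the situation of the last two entries of a pattern
    occurrence.\<close>
  then have *: "\<pi> ! y < \<pi> ! z" if "x < y" "y < z" "z < length \<pi>" for x y z
    using that sorted_wrt_nth_less[of "(<)" "tl \<pi>" "y - 1" "z - 1"]
    by (auto simp: nth_tl)
  have "avoids \<pi> [a, b, c]" if "c < b" for a b c
    unfolding contains_pattern_3 using * that by (meson leD less_imp_le)
  then show ?L by simp
qed

text \<open>A strictly increasing list is determined by its set of entries, so the head fixes the
  tail.\<close>

lemma strict_sorted_tl_iff:
  assumes "distinct \<pi>" "set \<pi> = A" "A \<noteq> {}"
  shows "sorted_wrt (<) (tl \<pi>) \<longleftrightarrow> (\<exists>c \<in> A. \<pi> = c # sorted_list_of_set (A - {c :: nat}))"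
proof (cases \<pi>)
  case Nil
  with assms show ?thesis by simp
next
  case (Cons d ds)
  with assms have "set ds = A - {d}" "distinct ds" "d \<in> A" by auto
  then have "sorted_wrt (<) ds \<longleftrightarrow> ds = sorted_list_of_set (A - {d})"
    by (metis List.finite_set sorted_list_of_set.idem_if_sorted_distinct
        sorted_list_of_set.strict_sorted_key_list_of_set strict_sorted_iff map_ident)
  with Cons \<open>d \<in> A\<close> show ?thesis by auto
qed

section \<open>Counting the labellings\<close>

text \<open>Consecutive north steps give neighbours in \<open>\<phi> p\<close>, so an increasing
  word satisfies the labelling condition on every path.\<close>

lemma consecutive_norths_increasing:
  assumes "sorted_wrt (<) (\<phi> p)" "Suc i < length p" "p ! i = North a" "p ! Suc i = North b"
  shows "a < b"
proof -
  have "p = take i p @ North a # North b # drop (Suc (Suc i)) p"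
    using assms by (metis Cons_nth_drop_Suc Suc_lessD append_take_drop_id)
  then have "\<phi> p = \<phi> (take i p) @ a # b # \<phi> (drop (Suc (Suc i)) p)"
    by (metis \<phi>_simps(2,3))
  with assms(1) show ?thesis by (simp add: sorted_wrt_append)
qed

text \<open>The bijective labelling already forces n north steps.\<close>

lemma parking_function_iff:
  "parking_function n p \<longleftrightarrow>
    ballot_path p \<and> x_coord p = n \<and> distinct (\<phi> p) \<and> set (\<phi> p) = {1..n} \<and>
    (\<forall>i a b. Suc i < length p \<and> p ! i = North a \<and> p ! Suc i = North b \<longrightarrow> a < b)"
proof -
  have "y_coord p = n" if "distinct (\<phi> p)" "set (\<phi> p) = {1..n}"
    using that distinct_card[of "\<phi> p"] by (simp add: length_\<phi>)
  then show ?thesis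
    by (auto simp: parking_function_def dyck_path_def ballot_path_def)
qed

lemma parking_functions_sorted:
  assumes "sorted_wrt (<) \<pi>" "set \<pi> = {1..n}"
  shows "{p. parking_function n p \<and> \<phi> p = \<pi>} = ballot_paths \<pi> n"
  using assms
  by (auto simp: parking_function_iff ballot_paths_def strict_sorted_iff
      intro: consecutive_norths_increasing)

lemma parking_functions_descent:
  assumes "sorted_wrt (<) (d # ds)" "d < c" "distinct (c # d # ds)" "set (c # d # ds) = {1..Suc m}"
  shows "{p. parking_function (Suc m) p \<and> \<phi> p = c # d # ds} =
    (\<lambda>q. North c # East # q) ` ballot_paths (d # ds) m" (is "?L = ?R")
proof
  show "?L \<subseteq> ?R"
  proof
    fix p assume "p \<in> ?L"
    then have p: "parking_function (Suc m) p" "\<phi> p = c # d # ds" by simp_all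
    then have b: "ballot_path p" "x_coord p = Suc m"
      and inc: "\<And>i a b. Suc i < length p \<Longrightarrow> p ! i = North a \<Longrightarrow> p ! Suc i = North b \<Longrightarrow> a < b"
      by (auto simp: parking_function_iff)
    obtain s t q where pq: "p = s # t # q"
      using p(2) by (cases p; cases "tl p"; cases "hd p") auto
    \<comment> \<open>A first step east would end at (1,0), below the diagonal.\<close>
    have "x_coord (take 1 p) \<le> y_coord (take 1 p)"
      using b(1) pq unfolding ballot_path_def by (elim allE[of _ 1]) simp
    then have "s = North c" using pq p(2) by (cases s) auto
    moreover have "t = East"
    proof (cases t)
      case (North e)
      then show ?thesis using inc[of 0 c e] pq p(2) \<open>s = North c\<close> assms(2) by simp
    qed simp
    ultimately show "p \<in> ?R" using pq p(2) b by (simp add: ballot_paths_def)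
  qed
next
  show "?R \<subseteq> ?L"
  proof
    fix p assume "p \<in> ?R"
    then obtain q where q: "p = North c # East # q" "q \<in> ballot_paths (d # ds) m" by auto
    then have \<phi>q: "\<phi> q = d # ds" by (simp add: ballot_paths_def)
    have "a < b" if "Suc i < length p" "p ! i = North a" "p ! Suc i = North b" for i a b
    proof -
      \<comment> \<open>The step at position 1 is \<open>East\<close>, so two consecutive north
        steps must both lie in \<open>q\<close>.\<close>
      have "i \<noteq> 0" "i \<noteq> 1" using that q(1) by (intro notI, simp)+
      then obtain j where "i = Suc (Suc j)" by (metis One_nat_def not0_implies_Suc)
      then show ?thesis
        using that q(1) consecutive_norths_increasing[of q j a b] assms(1) \<phi>q by simp
    qed
    moreover have "ballot_path p" "x_coord p = Suc m" "distinct (\<phi> p)" "set (\<phi> p) = {1..Suc m}"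
      "\<phi> p = c # d # ds"
      using q assms(3,4) by (simp_all add: ballot_paths_def)
    ultimately show "p \<in> ?L"
      unfolding parking_function_iff mem_Collect_eq by blast
  qed
qed

lemma card_parking_functions_sorted_tl:
  assumes "c \<in> {1..n}"
  shows "real (card {p. parking_function n p \<and> \<phi> p = c # sorted_list_of_set ({1..n} - {c})}) =
    (if c = 1 then catalan n else catalan (n - 1))"
proof (cases "c = 1")
  case True
  let ?\<pi> = "1 # sorted_list_of_set ({1..n} - {1})"
  have "sorted_wrt (<) ?\<pi>" "set ?\<pi> = {1..n}" "length ?\<pi> = n"
    using assms True by auto
  then show ?thesis
    using True parking_functions_sorted[of ?\<pi> n] card_ballot_paths_catalan[of ?\<pi>] by simp
next
  case False
  then obtain m where m: "n = Suc m" using assms by (cases n) auto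
  let ?ds = "sorted_list_of_set ({1..n} - {c})"
  have ds: "sorted_wrt (<) ?ds" "set ?ds = {1..n} - {c}" "length ?ds = m" "distinct ?ds"
    using assms m by auto
  \<comment> \<open>Since \<open>c\<close> is not 1, the value 1 heads the increasing tail, which
    yields the descent at the start.\<close>
  have "1 \<in> set ?ds" using assms False ds(2) by auto
  then obtain d es where des: "?ds = d # es" by (cases ?ds) auto
  have "d \<le> 1" using \<open>1 \<in> set ?ds\<close> ds(1) unfolding des by auto
  then have "d < c" using assms False by auto
  moreover have "distinct (c # ?ds)" "set (c # ?ds) = {1..n}"
    using ds assms by auto
  ultimately have "{p. parking_function n p \<and> \<phi> p = c # ?ds} =
      (\<lambda>q. North c # East # q) ` ballot_paths ?ds m"
    using parking_functions_descent[of d es c m, folded des m] ds(1) by simp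
  moreover have "inj (\<lambda>q. North c # East # q)" by (simp add: inj_def)
  ultimately show ?thesis
    using card_ballot_paths_catalan[of ?ds] ds(3) False m
    by (simp add: card_image inj_on_subset[of _ UNIV])
qed

theorem theorem14:
  fixes n :: nat
  assumes "n \<ge> 1"
  shows "real (pf n {[1, 3, 2], [2, 3, 1], [3, 2, 1]}) = catalan n + (real n - 1) * catalan (n - 1)"
proof -
  let ?P = "\<lambda>c. {p. parking_function n p \<and> \<phi> p = c # sorted_list_of_set ({1..n} - {c})}"
  have "(\<forall>\<rho> \<in> {[1, 3, 2], [2, 3, 1], [3, 2, 1]}. avoids (\<phi> p) \<rho>) \<longleftrightarrow>
      (\<exists>c \<in> {1..n}. \<phi> p = c # sorted_list_of_set ({1..n} - {c}))" if "parking_function n p" for p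
  proof -
    have "distinct (\<phi> p)" "set (\<phi> p) = {1..n}" using that by (simp_all add: parking_function_def)
    then show ?thesis
      using assms avoids_132_231_321_iff strict_sorted_tl_iff[of "\<phi> p" "{1..n}"] by simp
  qed
  then have "{p. parking_function n p \<and> (\<forall>\<rho> \<in> {[1, 3, 2], [2, 3, 1], [3, 2, 1]}. avoids (\<phi> p) \<rho>)} =
      (\<Union>c \<in> {1..n}. ?P c)"
    by blast
  then have "pf n {[1, 3, 2], [2, 3, 1], [3, 2, 1]} = card (\<Union>c \<in> {1..n}. ?P c)"
    by (simp only: pf_def)
  also have "\<dots> = (\<Sum>c \<in> {1..n}. card (?P c))"
  \<comment> \<open>Disjointness holds because \<open>c\<close> is the head of
    \<open>\<phi> p\<close>; finiteness comes from the ballot paths with the same word.\<close>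
  proof (rule card_UN_disjoint)
    have "?P c \<subseteq> ballot_paths (c # sorted_list_of_set ({1..n} - {c})) n" for c
      by (auto simp: ballot_paths_def parking_function_iff)
    then show "\<forall>c \<in> {1..n}. finite (?P c)"
      using finite_subset[OF _ finite_ballot_paths] by blast
  qed auto
  finally have "real (pf n {[1, 3, 2], [2, 3, 1], [3, 2, 1]}) =
      (\<Sum>c \<in> {1..n}. if c = 1 then catalan n else catalan (n - 1))"
    using card_parking_functions_sorted_tl by (simp del: One_nat_def)
  also have "\<dots> = catalan n + (\<Sum>c \<in> {1..n} - {1}. catalan (n - 1))"
    using assms by (subst sum.remove[of _ 1]) auto
  also have "\<dots> = catalan n + (real n - 1) * catalan (n - 1)"
    using assms by (simp add: of_nat_diff)
  finally show ?thesis .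
qed

end
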